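(* Fix $0<\sigma\le1$. In the inequality below the exponent $2-\sigma$ of the shading density cannot be replaced, uniformly over $\delta\le a\le b\le r$, by a smaller one. Precisely, let $q'<2-\sigma$ and $0<\varepsilon<2-\sigma-q'$. Then there do not exist constants $c>0$ and $\delta_0>0$ (which may depend on $\sigma,q',\varepsilon$ but not on $\delta,a,b,r$) such that, for every $0<\delta<\delta_0$, every $\delta\le a\le b\le r$, every $a\times b\times r$ box $B\subset\mathbb R^3$ and every labelled family $\mathcal T_B$ of $N\ge1$ $\delta\times\delta\times r$ tubes contained in $B$ with measurable shadings $Y(T)\subset T$ satisfying $$\frac{\#\{T\in\mathcal T_B:T\subset K\}}{N}\le C_0\left(\frac{|K|}{|B|}\right)^{1+\sigma}\qquad\text{for every convex }K\subset B$$ with a uniformly bounded constant $C_0$ (i.e. $C_0\le C_*$ for a suitable finite $C_*$ independent of $\delta,a,b,r$), one has $$\frac{|B\cap N_a(U(\mathcal T_B,Y))|}{|B|}\ge c\,(a/b)^{\varepsilon}\lambda_B^{q'} .$$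
   Context: Labels: families are indexed, different labels may have the same tube, and counts are over labels. $U(\mathcal T_B,Y)=\bigcup_{T}Y(T)$, $\lambda_B=\sum_T|Y(T)|/\sum_T|T|$, $N_a(E)=\{x:\operatorname{dist}(x,E)<a\}$, $|\cdot|$ is Lebesgue measure. A $\delta\times\delta\times r$ tube is the closed neighbourhood, of radius comparable to $\delta$ with fixed structural constants, of a segment of length in $[c_{\rm len}r,C_{\rm len}r]$ (endpoint caps included); an $a\times b\times r$ box has side lengths comparable to $a,b,r$ with fixed structural constants. *)

theory Defs
  imports "HOL-Analysis.Analysis"
begin

abbreviation vol :: "(real^3) set \<Rightarrow> real" where
  "vol \<equiv> measure lebesgue"

text \<open>
  The structural constants are explicit parameters: radii of tubes lie in
  \<open>[c_rad * \<delta>, C_rad * \<delta>]\<close>, lengths of their core segments in \<open>[c_len * r, C_len * r]\<close>, and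
  the sides of boxes in \<open>[c_box * a, C_box * a]\<close>, and likewise for \<open>b\<close>, \<open>r\<close>.
\<close>

definition is_tube :: "real \<Rightarrow> real \<Rightarrow> real \<Rightarrow> real \<Rightarrow> real \<Rightarrow> real \<Rightarrow> (real^3) set \<Rightarrow> bool" where
  "is_tube c_rad C_rad c_len C_len \<delta> r T \<longleftrightarrow>
     (\<exists>p q \<rho>. c_rad * \<delta> \<le> \<rho> \<and> \<rho> \<le> C_rad * \<delta> \<and>
        c_len * r \<le> dist p q \<and> dist p q \<le> C_len * r \<and>
        T = {x. infdist x (closed_segment p q) \<le> \<rho>})"

text \<open>Boxes are closed and arbitrarily positioned and oriented.\<close>

definition is_box :: "real \<Rightarrow> real \<Rightarrow> real \<Rightarrow> real \<Rightarrow> real \<Rightarrow> (real^3) set \<Rightarrow> bool" where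
  "is_box c_box C_box a b r B \<longleftrightarrow>
     (\<exists>(f :: real^3 \<Rightarrow> real^3) p l1 l2 l3. orthogonal_transformation f \<and>
        l1 \<in> {c_box * a..C_box * a} \<and> l2 \<in> {c_box * b..C_box * b} \<and> l3 \<in> {c_box * r..C_box * r} \<and>
        B = (\<lambda>x. p + f x) ` cbox 0 (vector [l1, l2, l3] :: real^3))"

text \<open>
  The distance to the empty set is infinite, so its neighbourhood is empty; the library's
  \<^const>\<open>infdist\<close> to the empty set is \<open>0\<close>, which has to be excluded.
\<close>

definition nbhd :: "real \<Rightarrow> (real^3) set \<Rightarrow> (real^3) set" where
  "nbhd a E = {x. E \<noteq> {} \<and> infdist x E < a}"

text \<open>
  A labelled family of \<open>N\<close> sets is a function on \<^typ>\<open>nat\<close> restricted to the labels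
  \<open>i < N\<close>; distinct labels may carry the same set.
\<close>

definition shaded_family ::
  "((real^3) set \<Rightarrow> bool) \<Rightarrow> (real^3) set \<Rightarrow> nat \<Rightarrow> (nat \<Rightarrow> (real^3) set) \<Rightarrow> (nat \<Rightarrow> (real^3) set) \<Rightarrow> bool" where
  "shaded_family tube B N T Y \<longleftrightarrow>
     (\<forall>i<N. tube (T i) \<and> T i \<subseteq> B \<and> Y i \<in> sets lebesgue \<and> Y i \<subseteq> T i)"

definition shaded_union :: "nat \<Rightarrow> (nat \<Rightarrow> (real^3) set) \<Rightarrow> (real^3) set" where
  "shaded_union N Y = (\<Union>i<N. Y i)"

definition shading_density :: "nat \<Rightarrow> (nat \<Rightarrow> (real^3) set) \<Rightarrow> (nat \<Rightarrow> (real^3) set) \<Rightarrow> real" where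
  "shading_density N T Y = (\<Sum>i<N. vol (Y i)) / (\<Sum>i<N. vol (T i))"

definition convex_concentration_le ::
  "real \<Rightarrow> real \<Rightarrow> (real^3) set \<Rightarrow> nat \<Rightarrow> (nat \<Rightarrow> (real^3) set) \<Rightarrow> bool" where
  "convex_concentration_le C s B N T \<longleftrightarrow>
     (\<forall>K. convex K \<and> K \<subseteq> B \<longrightarrow>
        real (card {i. i < N \<and> T i \<subseteq> K}) / real N \<le> C * (vol K / vol B) powr s)"

end

theory Submission
  imports Defs
begin

text \<open>
  The counterexamples are essentially planar. Take \<open>b = r = 1\<close>, let \<open>\<delta>\<close> be a fixed multiple of
  \<open>a\<close>, and let \<open>a \<rightarrow> 0\<close>, so that the box is a slab of thickness comparable to \<open>a\<close>. Inside a plane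
  of the slab mark about \<open>a\<^sup>-\<^sup>\<sigma>\<close> feet on a line and send out from every foot about \<open>1 / a\<close> tubes
  of radius comparable to \<open>a\<close>, in directions that are equally spaced and transversal to the line.
  Shade each tube only in the ball around its foot. A tube has volume comparable to \<open>a\<^sup>2\<close> and a
  ball has volume comparable to \<open>a\<^sup>3\<close>, so the density is comparable to \<open>a = a / b\<close>; but all the
  shadings together live in the balls around the feet, and the \<open>a\<close>-neighbourhood of their union
  occupies at most a constant times \<open>a\<^sup>-\<^sup>\<sigma> a\<^sup>3 / a = a powr (2 - \<sigma>)\<close> of the slab. The inequality
  would force \<open>a powr (2 - \<sigma>)\<close> to dominate \<open>a powr (\<epsilon> + q')\<close>, which fails for small \<open>a\<close> because
  \<open>\<epsilon> + q' < 2 - \<sigma>\<close>.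

  The concentration hypothesis asks that a convex set \<open>K\<close> occupying the proportion \<open>w\<close> of the slab
  contain at most the proportion \<open>w powr (1 + \<sigma>)\<close> of the tubes, up to a constant. If \<open>K\<close> contains
  two tubes, it contains their convex hull, whose volume is at least a constant times \<open>a\<close> times the
  distance of the feet, and also \<open>a\<close> times the difference of the slopes
  (lemma \<open>tubes_in_convex_volume\<close>; here transversality enters). Since the slab has volume comparable
  to \<open>a\<close>, the feet of the tubes in \<open>K\<close> lie in an interval of length \<open>O(w)\<close>, and so do the slopes.
  Equal spacing leaves a proportion \<open>O(w)\<close> of the slopes. The feet are placed at the points
  \<open>(j / M) powr (1 / \<sigma>)\<close>, \<open>j < M\<close>: subadditivity of \<open>x powr \<sigma>\<close> shows that an interval of
  length \<open>d\<close> contains at most \<open>M * d powr \<sigma> + 1\<close> of them, so that a proportion \<open>O(w powr \<sigma>)\<close>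
  remains. The rounding terms \<open>+ 1\<close> are absorbed because a convex set that contains a tube has
  \<open>w\<close> at least a constant times \<open>a\<close>.
\<close>

section \<open>Counting tools\<close>

text \<open>
  By homogeneity it is enough to treat \<open>x + y = 1\<close>, where \<open>t \<le> t powr s\<close> applies to both summands.
\<close>
lemma powr_subadditive:
  fixes x y s :: real
  assumes "0 \<le> x" "0 \<le> y" "0 < s" "s \<le> 1"
  shows "(x + y) powr s \<le> x powr s + y powr s"
proof (cases "x + y = 0")
  case True
  then show ?thesis using assms by simp
next
  case False
  then have pos: "0 < x + y" using assms by linarith
  have ge: "t \<le> t powr s" if "0 \<le> t" "t \<le> 1" for t :: real
    using powr_mono'[of s 1 t] that assms by simp
  have "1 = x / (x + y) + y / (x + y)"
    using pos by (simp add: add_divide_distrib [symmetric])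
  also have "\<dots> \<le> (x / (x + y)) powr s + (y / (x + y)) powr s"
    by (intro add_mono ge) (use assms pos in auto)
  also have "\<dots> = (x powr s + y powr s) / (x + y) powr s"
    using assms by (simp add: powr_divide add_divide_distrib)
  finally show ?thesis
    using pos by (simp add: field_simps)
qed

lemma card_le_spread:
  fixes J :: "nat set" and t :: real
  assumes "finite J" "0 \<le> t"
    and "\<And>i j. i \<in> J \<Longrightarrow> j \<in> J \<Longrightarrow> i \<le> j \<Longrightarrow> real j - real i \<le> t"
  shows "real (card J) \<le> t + 1"
proof (cases "J = {}")
  case True
  then show ?thesis using assms by simp
next
  case False
  define m where "m = Min J"
  define n where "n = Max J"
  have mn: "m \<in> J" "n \<in> J" "m \<le> n" "J \<subseteq> {m..n}"
    using False assms(1) by (auto simp: m_def n_def)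
  have "card J \<le> card {m..n}"
    by (rule card_mono) (use mn in auto)
  then have "real (card J) \<le> real n - real m + 1"
    using mn by simp
  then show ?thesis
    using assms(3)[OF mn(1,2,3)] by linarith
qed

section \<open>Volumes of convex sets and tubes\<close>
lemma vol_cuboid:
  assumes "0 \<le> x" "0 \<le> y" "0 \<le> z"
  shows "vol (cbox 0 (vector [x, y, z])) = x * y * z"
proof -
  have "cbox 0 (vector [x, y, z] :: real^3) \<noteq> {}"
    using assms by (auto simp: interval_ne_empty_cart forall_3)
  then show ?thesis
    using content_cbox_cart[of 0 "vector [x, y, z] :: real^3"] unfolding UNIV_3 by (simp add: mult.assoc)
qed

text \<open>
  The hypotheses put a triangular prism into \<open>K\<close>. Its own volume would give the constant \<open>1 / 2\<close>;
  the half-size parallelogram spanned at \<open>p\<close> already fits into the triangle, and the parallelepiped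
  over it is a linear image of the unit cube, whose volume is a determinant.
\<close>
lemma convex_prism_volume:
  fixes K :: "(real^3) set"
  assumes K: "convex K" "bounded K"
    and bottom: "p \<in> K" "q \<in> K" "z \<in> K"
    and top: "p + u \<in> K" "q + u \<in> K" "z + u \<in> K"
  shows "\<bar>det (vector [u, q - p, z - p] :: real^3^3)\<bar> / 4 \<le> vol K"
proof -
  define f :: "real^3 \<Rightarrow> real^3" where
    "f t = (t$1) *\<^sub>R u + (t$2 / 2) *\<^sub>R (q - p) + (t$3 / 2) *\<^sub>R (z - p)" for t
  let ?Q = "cbox 0 (vector [1, 1, 1]) :: (real^3) set"
  have lin: "linear f"
    by (rule linearI) (simp_all add: f_def algebra_simps add_divide_distrib scaleR_add_left)
  have Q: "?Q \<in> lmeasurable"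
    by simp
  have Qvol: "vol ?Q = 1"
    by (simp only: vol_cuboid zero_le_one mult_1)
  have "det (matrix f) = det (vector [u, q - p, z - p] :: real^3^3) / 4"
    unfolding det_3 by (simp add: matrix_def f_def axis_def) (simp add: algebra_simps add_divide_distrib diff_divide_distrib)?
  then have "vol (f ` ?Q) = \<bar>det (vector [u, q - p, z - p] :: real^3^3)\<bar> / 4"
    using measure_linear_image[OF lin Q] Qvol by simp
  then have vol: "vol ((+) p ` f ` ?Q) = \<bar>det (vector [u, q - p, z - p] :: real^3^3)\<bar> / 4"
    by (simp add: measure_translation)
  have "(+) p ` f ` ?Q \<subseteq> K"
  proof clarsimp
    fix t :: "real^3"
    assume "t \<in> ?Q"
    then have t: "0 \<le> t$1" "t$1 \<le> 1" "0 \<le> t$2" "t$2 \<le> 1" "0 \<le> t$3" "t$3 \<le> 1"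
      by (auto simp: mem_box_cart forall_3)
    have tri: "(1 - t$2/2 - t$3/2) *\<^sub>R x + (t$2/2) *\<^sub>R y + (t$3/2) *\<^sub>R w \<in> K"
      if "x \<in> K" "y \<in> K" "w \<in> K" for x y w
    proof -
      have "(\<Sum>i\<in>{1..3::nat}. (if i = 1 then 1 - t$2/2 - t$3/2 else if i = 2 then t$2/2 else t$3/2)
           *\<^sub>R (if i = 1 then x else if i = 2 then y else w)) \<in> K"
        using K(1) that t by (intro convex_sum) (auto simp: numeral_3_eq_3)
      then show ?thesis by (simp add: numeral_3_eq_3)
    qed
    have "p + f t = (1 - t$1) *\<^sub>R ((1 - t$2/2 - t$3/2) *\<^sub>R p + (t$2/2) *\<^sub>R q + (t$3/2) *\<^sub>R z)
       + (t$1) *\<^sub>R ((1 - t$2/2 - t$3/2) *\<^sub>R (p + u) + (t$2/2) *\<^sub>R (q + u) + (t$3/2) *\<^sub>R (z + u))"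
      by (simp add: f_def vec_eq_iff field_simps)
    also have "\<dots> \<in> K"
      using t by (intro convexD[OF K(1)] tri bottom top) auto
    finally show "p + f t \<in> K" .
  qed
  moreover have "(+) p ` f ` ?Q \<in> sets lebesgue"
    using measurable_linear_image[OF lin Q] measurable_translation by blast
  ultimately have "vol ((+) p ` f ` ?Q) \<le> vol K"
    using measurable_convex[OF K] by (intro measure_mono_fmeasurable) auto
  then show ?thesis
    using vol by simp
qed

abbreviation tube :: "real \<Rightarrow> real^3 \<Rightarrow> real^3 \<Rightarrow> (real^3) set" where
  "tube \<rho> p q \<equiv> {x. infdist x (closed_segment p q) \<le> \<rho>}"

text \<open>
  This form yields both the convexity of tubes, as Minkowski sums of a segment and a ball, and
  coverings of tubes by balls.
\<close>
lemma tube_eq_Union_cball: "tube \<rho> p q = (\<Union>y\<in>closed_segment p q. cball y \<rho>)"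
proof (intro set_eqI iffI)
  fix x assume "x \<in> tube \<rho> p q"
  moreover obtain y where "y \<in> closed_segment p q" "infdist x (closed_segment p q) = dist x y"
    by (rule infdist_attains_inf[of "closed_segment p q" x]) auto
  ultimately show "x \<in> (\<Union>y\<in>closed_segment p q. cball y \<rho>)"
    by (auto simp: dist_commute)
next
  fix x assume "x \<in> (\<Union>y\<in>closed_segment p q. cball y \<rho>)"
  then show "x \<in> tube \<rho> p q"
    by (auto simp: dist_commute intro: infdist_le2)
qed

lemma convex_tube: "convex (tube \<rho> p q)"
proof -
  have "tube \<rho> p q = (\<Union>y\<in>closed_segment p q. \<Union>v\<in>cball 0 \<rho>. {y + v})"
    unfolding tube_eq_Union_cball by (force simp: dist_norm norm_minus_commute intro: bexI[of _ "x - y" for x y])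
  then show ?thesis
    using convex_sums[OF convex_closed_segment convex_cball] by metis
qed

lemma bounded_tube: "bounded (tube \<rho> p q)"
proof -
  obtain R where R: "\<And>x. x \<in> closed_segment p q \<Longrightarrow> norm x \<le> R"
    using bounded_closed_segment bounded_iff by metis
  have "tube \<rho> p q \<subseteq> cball 0 (R + \<rho>)"
    unfolding tube_eq_Union_cball using R by (auto simp: dist_norm) (smt (verit) norm_triangle_sub norm_minus_commute)
  then show ?thesis
    by (rule bounded_subset[OF bounded_cball])
qed

text \<open>
  The \<open>n + 1\<close> equally spaced points on the core are at most \<open>\<rho>\<close> apart, so the balls of
  radius \<open>2 * \<rho>\<close> around them cover the tube.
\<close>
lemma tube_volume_le:
  assumes "0 < \<rho>" and "dist p q \<le> real n * \<rho>" "0 < n"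
  shows "vol (tube \<rho> p q) \<le> real (Suc n) * (8 * unit_ball_vol 3 * \<rho> ^ 3)"
proof -
  define c where "c i = p + (real i / real n) *\<^sub>R (q - p)" for i
  have sub: "tube \<rho> p q \<subseteq> (\<Union>i\<le>n. cball (c i) (2 * \<rho>))"
  proof
    fix x assume "x \<in> tube \<rho> p q"
    then obtain y where y: "y \<in> closed_segment p q" "dist y x \<le> \<rho>"
      unfolding tube_eq_Union_cball by auto
    then obtain t where t: "0 \<le> t" "t \<le> 1" "y = p + t *\<^sub>R (q - p)"
      by (auto simp: in_segment algebra_simps)
    define i where "i = nat \<lfloor>t * n\<rfloor>"
    have i: "real i \<le> t * n" "t * n \<le> real i + 1"
      unfolding i_def using t by auto
    have "real i \<le> n"
      using i(1) t(2) mult_right_mono[of t 1 "real n"] by simp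
    then have "i \<le> n" by simp
    have "dist (c i) y = \<bar>real i / n - t\<bar> * dist p q"
      by (simp add: c_def t(3) dist_norm norm_minus_commute flip: scaleR_diff_left)
    also have "\<dots> = \<bar>real i - t * n\<bar> / n * dist p q"
      using assms by (simp add: field_simps abs_divide)
    also have "\<dots> \<le> 1 / n * (n * \<rho>)"
      using i assms by (intro mult_mono divide_right_mono) auto
    also have "\<dots> = \<rho>" using assms by simp
    finally have "dist (c i) x \<le> 2 * \<rho>"
      using y(2) dist_triangle[of "c i" x y] by linarith
    then show "x \<in> (\<Union>i\<le>n. cball (c i) (2 * \<rho>))"
      using \<open>i \<le> n\<close> by auto
  qed
  have "vol (tube \<rho> p q) \<le> vol (\<Union>i\<le>n. cball (c i) (2 * \<rho>))"
    using sub measurable_convex[OF convex_tube bounded_tube]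
    by (intro measure_mono_fmeasurable) (auto intro!: fmeasurable.finite_UN)
  also have "\<dots> \<le> (\<Sum>i\<le>n. vol (cball (c i) (2 * \<rho>)))"
    by (intro measure_UNION_le) auto
  also have "\<dots> = real (Suc n) * (8 * unit_ball_vol 3 * \<rho> ^ 3)"
    using assms by (simp add: content_cball power_mult_distrib)
  finally show ?thesis .
qed

text \<open>
  Thickening a triangle in a plane orthogonal to the first axis by balls of radius \<open>\<eta>\<close> contains
  the prism of height \<open>2 * \<eta>\<close> over it; the factor next to \<open>\<eta>\<close> is twice the area of the triangle.
\<close>
lemma planar_triangle_volume:
  fixes K :: "(real^3) set"
  assumes K: "convex K" "bounded K" and "0 \<le> \<eta>"
    and plane: "q$1 = p$1" "z$1 = p$1"
    and balls: "cball p \<eta> \<subseteq> K" "cball q \<eta> \<subseteq> K" "cball z \<eta> \<subseteq> K"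
  shows "\<eta> * \<bar>(q$2 - p$2) * (z$3 - p$3) - (q$3 - p$3) * (z$2 - p$2)\<bar> \<le> 2 * vol K"
proof -
  define e :: "real^3" where "e = axis 1 1"
  have e: "norm e = 1" "e$1 = 1" "e$2 = 0" "e$3 = 0"
    by (simp_all add: e_def axis_def norm_axis_1[unfolded axis_def])
  have mem: "x - \<eta> *\<^sub>R e \<in> K" "(x - \<eta> *\<^sub>R e) + (2 * \<eta>) *\<^sub>R e \<in> K" if "cball x \<eta> \<subseteq> K" for x
  proof -
    have "x - \<eta> *\<^sub>R e \<in> cball x \<eta>" "x + \<eta> *\<^sub>R e \<in> cball x \<eta>"
      using e(1) \<open>0 \<le> \<eta>\<close> by (simp_all add: dist_norm)
    moreover have "(x - \<eta> *\<^sub>R e) + (2 * \<eta>) *\<^sub>R e = x + \<eta> *\<^sub>R e"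
      by (simp add: vec_eq_iff algebra_simps)
    ultimately show "x - \<eta> *\<^sub>R e \<in> K" "(x - \<eta> *\<^sub>R e) + (2 * \<eta>) *\<^sub>R e \<in> K"
      using that by (auto simp only: subset_eq)
  qed
  have "det (vector [(2 * \<eta>) *\<^sub>R e, q - p, z - p] :: real^3^3)
      = 2 * \<eta> * ((q$2 - p$2) * (z$3 - p$3) - (q$3 - p$3) * (z$2 - p$2))"
    using e plane unfolding det_3 by (simp add: algebra_simps)
  moreover have "\<bar>det (vector [(2 * \<eta>) *\<^sub>R e, q - p, z - p] :: real^3^3)\<bar> \<le> 4 * vol K"
    using convex_prism_volume[OF K mem(1) mem(1) mem(1) mem(2) mem(2) mem(2),
        OF balls balls] by simp
  ultimately show ?thesis
    using \<open>0 \<le> \<eta>\<close> by (simp add: abs_mult)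
qed

section \<open>Tubes in a plane\<close>

text \<open>
  Unit vectors in the plane of the construction are parametrised by the sine \<open>s\<close> of their angle to
  the third axis, so that segments of a prescribed length need no normalisation.
\<close>
definition dir :: "real \<Rightarrow> real^3" where
  "dir s = vector [0, s, sqrt (1 - s\<^sup>2)]"

lemma dir_simps [simp]: "dir s $ 1 = 0" "dir s $ 2 = s" "dir s $ 3 = sqrt (1 - s\<^sup>2)"
  by (simp_all add: dir_def)

lemma norm_dir: "\<bar>s\<bar> \<le> 1 \<Longrightarrow> norm (dir s) = 1"
  by (simp add: norm_vec_def L2_set_def sum_3 abs_square_le_1)

text \<open>
  The upper bound keeps the extent of a core along the third axis well below its length. This leaves room for the end caps when the cores are as long as the box, while the lower
  bound makes all directions transversal to the line of feet.
\<close>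
lemma slope_bounds:
  fixes s :: real
  assumes "1/4 \<le> s" "s \<le> 1/2"
  shows "1/2 \<le> sqrt (1 - s\<^sup>2)" "sqrt (1 - s\<^sup>2) \<le> 31/32"
proof -
  have "(1/4)\<^sup>2 \<le> s\<^sup>2" "s\<^sup>2 \<le> (1/2)\<^sup>2"
    using assms by (intro power_mono; simp)+
  then have *: "(1/2)\<^sup>2 \<le> 1 - s\<^sup>2" "1 - s\<^sup>2 \<le> (31/32)\<^sup>2"
    by (simp_all add: power2_eq_square)
  show "1/2 \<le> sqrt (1 - s\<^sup>2)"
    by (rule real_le_rsqrt) (rule *(1))
  show "sqrt (1 - s\<^sup>2) \<le> 31/32"
    by (rule real_le_lsqrt[OF _ *(2)]) simp
qed

lemma cball_subset_tube:
  assumes "y \<in> closed_segment p q" "dist y x + \<eta> \<le> \<rho>"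
  shows "cball x \<eta> \<subseteq> tube \<rho> p q"
proof
  fix w assume "w \<in> cball x \<eta>"
  then have "dist w y \<le> \<rho>"
    using assms(2) dist_triangle[of y w x] by (simp add: dist_commute)
  then show "w \<in> tube \<rho> p q"
    using assms(1) by (auto intro: infdist_le2)
qed

text \<open>
  All three bounds come from triangles that have the first core as one side. The third vertex is,
  respectively, a point at distance \<open>\<rho> / 2\<close> beside the foot \<open>p\<close>, the other foot \<open>p'\<close>, and the far
  end of the other core. In the last case the area is a difference of a turning term, comparable to
  \<open>h\<^sup>2 * \<bar>s - s'\<bar>\<close>, and the area already controlled by the distance of the feet. The balls of radius
  \<open>\<rho> / 2\<close> around the three vertices stay inside the tubes.
\<close>
lemma tubes_in_convex_volume:
  fixes p p' :: "real^3"
  assumes K: "convex K" "bounded K" and pos: "0 < \<rho>" "0 < h"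
    and s: "1/4 \<le> s" "s \<le> 1/2" and s': "1/4 \<le> s'" "s' \<le> 1/2"
    and p': "p'$1 = p$1" "p'$3 = p$3"
    and T: "tube \<rho> p (p + h *\<^sub>R dir s) \<subseteq> K" and T': "tube \<rho> p' (p' + h *\<^sub>R dir s') \<subseteq> K"
  shows "\<rho>\<^sup>2 * h \<le> 16 * vol K"
    and "\<rho> * h * \<bar>p'$2 - p$2\<bar> \<le> 8 * vol K"
    and "\<rho> * h\<^sup>2 * \<bar>s - s'\<bar> \<le> 16 * vol K"
proof -
  let ?q = "p + h *\<^sub>R dir s" and ?q' = "p' + h *\<^sub>R dir s'"
  define c c' where "c = sqrt (1 - s\<^sup>2)" and "c' = sqrt (1 - s'\<^sup>2)"
  have c: "1/2 \<le> c" "1/2 \<le> c'"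
    using slope_bounds[OF s] slope_bounds[OF s'] by (simp_all add: c_def c'_def)
  have ball: "cball p (\<rho>/2) \<subseteq> K" "cball ?q (\<rho>/2) \<subseteq> K" "cball p' (\<rho>/2) \<subseteq> K" "cball ?q' (\<rho>/2) \<subseteq> K"
    by (rule order_trans[OF cball_subset_tube T] order_trans[OF cball_subset_tube T'],
        rule ends_in_segment, use pos in simp)+
  note area = planar_triangle_volume[OF K _ _ _ ball(1,2)]
  define e :: "real^3" where "e = axis 2 1"
  have e: "norm e = 1" "e$1 = 0" "e$2 = 1" "e$3 = 0"
    by (simp_all add: e_def axis_def norm_axis_1[unfolded axis_def])
  have "cball (p + (\<rho>/2) *\<^sub>R e) (\<rho>/2) \<subseteq> K"
    using pos e by (intro order_trans[OF cball_subset_tube[of p] T]) (auto simp: dist_norm)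
  then have "\<rho>/2 * \<bar>h * c * (\<rho>/2)\<bar> \<le> 2 * vol K"
    using area[of "p + (\<rho>/2) *\<^sub>R e"] pos by (simp add: e c_def)
  moreover have "\<rho>/2 * (h * (1/2) * (\<rho>/2)) \<le> \<rho>/2 * \<bar>h * c * (\<rho>/2)\<bar>"
    using pos c by (intro mult_left_mono order_trans[OF _ abs_ge_self] mult_right_mono) auto
  ultimately show "\<rho>\<^sup>2 * h \<le> 16 * vol K"
    by (simp add: power2_eq_square)
  have foot: "\<rho>/2 * \<bar>h * c * (p'$2 - p$2)\<bar> \<le> 2 * vol K"
    using area[of p'] pos p' ball by (simp add: c_def)
  moreover have "\<rho>/2 * (h * (1/2) * \<bar>p'$2 - p$2\<bar>) \<le> \<rho>/2 * \<bar>h * c * (p'$2 - p$2)\<bar>"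
    unfolding abs_mult using pos c by (intro mult_left_mono mult_right_mono) auto
  ultimately show "\<rho> * h * \<bar>p'$2 - p$2\<bar> \<le> 8 * vol K"
    by simp
  have "\<rho>/2 * \<bar>h * h * (s * c' - c * s') - h * c * (p'$2 - p$2)\<bar> \<le> 2 * vol K"
    using area[of ?q'] pos p' ball by (simp add: c_def c'_def algebra_simps)
  moreover have "\<rho>/2 * \<bar>h * h * (s * c' - c * s')\<bar>
     \<le> \<rho>/2 * (\<bar>h * h * (s * c' - c * s') - h * c * (p'$2 - p$2)\<bar> + \<bar>h * c * (p'$2 - p$2)\<bar>)"
    using pos by (intro mult_left_mono) auto
  ultimately have turn: "\<rho>/2 * \<bar>h * h * (s * c' - c * s')\<bar> \<le> 4 * vol K"
    using foot by (simp add: distrib_left)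
  \<comment> \<open>The right-hand side is the absolute value of the sine of the angle between the cores.\<close>
  have "1/2 * \<bar>s - s'\<bar> \<le> \<bar>s * c' - c * s'\<bar>"
  proof -
    have mono: "sqrt (1 - u\<^sup>2) \<le> sqrt (1 - v\<^sup>2)" if "1/4 \<le> v" "v \<le> u" for u v :: real
      using power_mono[of v u 2] that by simp
    have *: "1/2 * (u - v) \<le> u * d - e * v" if "1/2 \<le> d" "e \<le> d" "v \<le> u" "1/4 \<le> v" for u v d e :: real
    proof -
      have "1/2 * (u - v) \<le> d * (u - v)" using that by (intro mult_right_mono) auto
      also have "\<dots> \<le> u * d - e * v" using that mult_right_mono[of e d v] by (simp add: algebra_simps)
      finally show ?thesis .
    qed
    show ?thesis
    proof (cases "s' \<le> s")
      case True
      then have "c \<le> c'" using mono s' by (simp add: c_def c'_def)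
      then show ?thesis using *[of c' c s' s] c s' True by simp
    next
      case False
      then have "c' \<le> c" using mono s by (simp add: c_def c'_def)
      then show ?thesis using *[of c c' s s'] c s False by (simp add: mult.commute)
    qed
  qed
  then have "\<rho>/2 * (h * h * (1/2 * \<bar>s - s'\<bar>)) \<le> \<rho>/2 * \<bar>h * h * (s * c' - c * s')\<bar>"
    using pos unfolding abs_mult by (intro mult_left_mono) auto
  then show "\<rho> * h\<^sup>2 * \<bar>s - s'\<bar> \<le> 16 * vol K"
    using turn by (simp add: power2_eq_square mult.assoc)
qed

section \<open>The family of tubes\<close>

text \<open>
  With \<open>w\<close> the proportion of the slab occupied by a convex set, the terms \<open>64 * L\<^sup>2 / (\<kappa> * h)\<close> and
  \<open>64 * L ^ 3 / (\<kappa> * h\<^sup>2)\<close> bound the spread of offsets and slopes of the tubes inside it in units of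
  \<open>w\<close>, and \<open>16 * L ^ 3 / (\<kappa>\<^sup>2 * h)\<close> bounds \<open>a / w\<close>. That \<open>a\<close> does not occur is what makes the
  concentration uniform.
\<close>
definition concentration_bound :: "real \<Rightarrow> real \<Rightarrow> real \<Rightarrow> real \<Rightarrow> real" where
  "concentration_bound \<sigma> L h \<kappa> =
     ((64 * L\<^sup>2 / (\<kappa> * h)) powr \<sigma> + (16 * L ^ 3 / (\<kappa>\<^sup>2 * h)) powr \<sigma>)
     * (64 * L ^ 3 / (\<kappa> * h\<^sup>2) + 16 * L ^ 3 / (\<kappa>\<^sup>2 * h))"

text \<open>
  The slab has sides \<open>L * a\<close>, \<open>L\<close>, \<open>L\<close>, and the tubes have radius \<open>\<kappa> * a\<close> and core length \<open>h\<close>,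
  which may equal \<open>L\<close>. Only \<open>a\<close> varies in the application; every estimate is uniform in it.
\<close>
locale transversal_tubes =
  fixes \<sigma> L h \<kappa> a :: real
  assumes \<sigma>: "0 < \<sigma>" "\<sigma> \<le> 1"
    and h: "0 < h" "h \<le> L"
    and \<kappa>: "0 < \<kappa>" "2 * \<kappa> \<le> L"
    and a: "0 < a" "a \<le> 1" "\<kappa> * a \<le> L / 64" "\<kappa> * a \<le> h"
begin

definition radius :: real where "radius = \<kappa> * a"

definition feet :: nat where "feet = nat \<lceil>a powr - \<sigma>\<rceil>"

definition slopes :: nat where "slopes = nat \<lceil>1 / a\<rceil>"

text \<open>
  The \<open>\<sigma>\<close>-dimensional spacing of the feet: an elementary substitute for a Cantor set of
  dimension \<open>\<sigma>\<close>, as far as upper bounds on the number of points in an interval are concerned.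
\<close>
definition offset :: "nat \<Rightarrow> real" where
  "offset j = (real j / real feet) powr (1 / \<sigma>)"

definition foot :: "nat \<Rightarrow> real^3" where
  "foot j = vector [L * a / 2, L / 8 + L / 8 * offset j, L / 64]"

definition slope :: "nat \<Rightarrow> real" where
  "slope k = 1/4 + real k / (4 * real slopes)"

text \<open>
  A label \<open>i < feet * slopes\<close> encodes the foot \<open>i div slopes\<close> and the slope \<open>i mod slopes\<close>.
\<close>
definition member :: "nat \<Rightarrow> (real^3) set" where
  "member i = (let p = foot (i div slopes) in
     tube radius p (p + h *\<^sub>R dir (slope (i mod slopes))))"

definition shading :: "nat \<Rightarrow> (real^3) set" where
  "shading i = cball (foot (i div slopes)) radius"

definition slab :: "(real^3) set" where
  "slab = cbox 0 (vector [L * a, L, L])"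

lemma L_pos: "0 < L"
  using h by linarith

lemma radius_pos: "0 < radius"
  using \<kappa> a by (simp add: radius_def)

lemma feet_bounds: "a powr - \<sigma> \<le> feet" "real feet \<le> 2 * a powr - \<sigma>" "0 < feet"
proof -
  have "1 \<le> a powr - \<sigma>"
    using a \<sigma> by (simp add: powr_minus powr_le1 one_le_inverse_iff)
  then show "a powr - \<sigma> \<le> feet" "real feet \<le> 2 * a powr - \<sigma>" "0 < feet"
    unfolding feet_def by linarith+
qed

lemma slopes_bounds: "1 / a \<le> slopes" "0 < slopes"
proof -
  have "1 \<le> 1 / a" using a by simp
  then show "1 / a \<le> slopes" "0 < slopes"
    unfolding slopes_def by linarith+
qed

lemma div_mod_label:
  assumes "i < feet * slopes"
  shows "i div slopes < feet" "i mod slopes < slopes"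
  using assms slopes_bounds by (simp_all add: less_mult_imp_div_less)

lemma offset_bounds: "j < feet \<Longrightarrow> 0 \<le> offset j \<and> offset j \<le> 1"
  using \<sigma> by (auto simp: offset_def intro!: powr_le1)

lemma slope_range:
  assumes "k < slopes"
  shows "1/4 \<le> slope k" "slope k \<le> 1/2"
proof -
  have "real k / (4 * real slopes) \<le> 1/4"
    using assms by (simp add: field_simps)
  then show "1/4 \<le> slope k" "slope k \<le> 1/2"
    by (simp_all add: slope_def)
qed

lemma vol_slab: "vol slab = L ^ 3 * a"
  using L_pos a by (simp add: slab_def vol_cuboid power3_eq_cube del: measure_completion)

text \<open>
  Along the second axis the feet stay in \<open>[L / 8, L / 4]\<close> and the cores advance by at most
  \<open>L / 2\<close>; along the third they start at \<open>L / 64\<close> and advance by at most \<open>31 / 32 * L\<close>. Hence a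
  margin of \<open>L / 64\<close>, at least the radius, remains on all sides in the plane.
\<close>
lemma member_subset_slab:
  assumes "i < feet * slopes"
  shows "member i \<subseteq> slab"
proof
  fix x assume x: "x \<in> member i"
  define j k where "j = i div slopes" and "k = i mod slopes"
  define s where "s = slope k"
  have jk: "j < feet" "k < slopes"
    using div_mod_label[OF assms] by (simp_all add: j_def k_def)
  have s: "1/4 \<le> s" "s \<le> 1/2"
    using slope_range[OF jk(2)] by (simp_all add: s_def)
  obtain y where y: "y \<in> closed_segment (foot j) (foot j + h *\<^sub>R dir s)" "dist y x \<le> radius"
    using x unfolding member_def Let_def tube_eq_Union_cball by (auto simp: j_def k_def s_def)
  then obtain t where t: "0 \<le> t" "t \<le> 1" "y = foot j + (t * h) *\<^sub>R dir s"
    by (auto simp: in_segment algebra_simps)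
  have th: "0 \<le> t * h" "t * h \<le> L"
    using t h mult_mono[of t 1 h L] by auto
  define c where "c = sqrt (1 - s\<^sup>2)"
  have c: "0 \<le> c" "c \<le> 31/32"
    using slope_bounds[OF s] unfolding c_def by linarith+
  have "t * h * s \<le> L * (1/2)" "0 \<le> t * h * s" "t * h * c \<le> L * (31/32)" "0 \<le> t * h * c"
    using th s c mult_mono[of "t * h" L s "1/2"] mult_mono[of "t * h" L c "31/32"]
      mult_nonneg_nonneg[of "t * h" s] mult_nonneg_nonneg[of "t * h" c] by linarith+
  moreover have "0 \<le> L / 8 * offset j" "L / 8 * offset j \<le> L / 8"
    using offset_bounds[OF jk(1)] L_pos by (auto simp: mult_le_cancel_left1)
  moreover have comp: "\<bar>x$l - y$l\<bar> \<le> radius" for l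
    using component_le_norm_cart[of "x - y" l] y(2) by (simp add: dist_norm norm_minus_commute)
  moreover have "radius \<le> L * a / 2" "radius \<le> L / 64"
    using \<kappa> a mult_right_mono[of "2 * \<kappa>" L a] by (simp_all add: radius_def)
  ultimately show "x \<in> slab"
    using comp[of 1] comp[of 2] comp[of 3]
    unfolding slab_def mem_box_cart forall_3
    by (simp add: t(3) foot_def c_def[symmetric] abs_le_iff)
qed

text \<open>
  The bounds of \<open>tubes_in_convex_volume\<close> in terms of labels.
\<close>
lemma members_in_convex_volume:
  assumes K: "convex K" "bounded K" and i: "i < feet * slopes" "member i \<subseteq> K"
    and i': "i' < feet * slopes" "member i' \<subseteq> K"
  shows "radius\<^sup>2 * h \<le> 16 * vol K"
    and "radius * h * (L / 8 * \<bar>offset (i' div slopes) - offset (i div slopes)\<bar>) \<le> 8 * vol K"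
    and "radius * h\<^sup>2 * (\<bar>real (i' mod slopes) - real (i mod slopes)\<bar> / (4 * slopes)) \<le> 16 * vol K"
proof -
  define p p' s s' where "p = foot (i div slopes)" and "p' = foot (i' div slopes)"
    and "s = slope (i' mod slopes)" and "s' = slope (i mod slopes)"
  have vol: "radius\<^sup>2 * h \<le> 16 * vol K" "radius * h * \<bar>p'$2 - p$2\<bar> \<le> 8 * vol K"
    "radius * h\<^sup>2 * \<bar>s - s'\<bar> \<le> 16 * vol K"
    using tubes_in_convex_volume[OF K radius_pos h(1), of s' s p' p] i i'
      slope_range div_mod_label[OF i(1)] div_mod_label[OF i'(1)]
    by (simp_all add: member_def Let_def p_def p'_def s_def s'_def foot_def abs_minus_commute)
  show "radius\<^sup>2 * h \<le> 16 * vol K"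
    by (rule vol)
  have "p'$2 - p$2 = L / 8 * (offset (i' div slopes) - offset (i div slopes))"
    by (simp add: p_def p'_def foot_def right_diff_distrib)
  then have "\<bar>p'$2 - p$2\<bar> = L / 8 * \<bar>offset (i' div slopes) - offset (i div slopes)\<bar>"
    using L_pos by (simp only: abs_mult)
  then show "radius * h * (L / 8 * \<bar>offset (i' div slopes) - offset (i div slopes)\<bar>) \<le> 8 * vol K"
    using vol(2) by metis
  have "s - s' = (real (i' mod slopes) - real (i mod slopes)) / (4 * slopes)"
    by (simp add: s_def s'_def slope_def diff_divide_distrib)
  then have "\<bar>s - s'\<bar> = \<bar>real (i' mod slopes) - real (i mod slopes)\<bar> / (4 * slopes)"
    by simp
  then show "radius * h\<^sup>2 * (\<bar>real (i' mod slopes) - real (i mod slopes)\<bar> / (4 * slopes)) \<le> 16 * vol K"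
    using vol(3) by metis
qed

text \<open>
  After raising offsets to the power \<open>\<sigma>\<close> the feet are equally spaced, and by subadditivity
  offsets at distance at most \<open>d\<close> then differ by at most \<open>d powr \<sigma>\<close>.
\<close>
lemma card_feet_le:
  assumes "finite J" "0 \<le> d"
    and close: "\<And>i j. i \<in> J \<Longrightarrow> j \<in> J \<Longrightarrow> \<bar>offset j - offset i\<bar> \<le> d"
  shows "real (card J) \<le> feet * d powr \<sigma> + 1"
proof (rule card_le_spread[OF \<open>finite J\<close>])
  fix i j assume ij: "i \<in> J" "j \<in> J" "i \<le> j"
  have offset_powr: "offset n powr \<sigma> = real n / feet" for n
    using \<sigma> by (simp add: offset_def powr_powr)
  have "real j / feet \<le> (offset i + d) powr \<sigma>"
    using close[OF ij(1,2)] \<sigma> unfolding offset_powr[symmetric]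
    by (intro powr_mono2) (auto simp: offset_def)
  also have "\<dots> \<le> real i / feet + d powr \<sigma>"
    using powr_subadditive[of "offset i" d \<sigma>] \<sigma> \<open>0 \<le> d\<close> unfolding offset_powr
    by (simp add: offset_def)
  finally show "real j - real i \<le> feet * d powr \<sigma>"
    using feet_bounds(3) by (simp add: field_simps)
qed auto

text \<open>
  The tubes inside \<open>K\<close> inject into pairs of a foot and a slope. Both coordinates are confined to
  intervals of length \<open>O(w)\<close>, where \<open>w\<close> is the proportion of the slab occupied by \<open>K\<close>, which
  leaves proportions \<open>O(w powr \<sigma>)\<close> of the feet and \<open>O(w)\<close> of the slopes.
\<close>
lemma concentration:
  "convex_concentration_le (concentration_bound \<sigma> L h \<kappa>) (1 + \<sigma>) slab (feet * slopes) member"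
  unfolding convex_concentration_le_def
proof (intro allI impI)
  fix K :: "(real^3) set"
  assume K: "convex K \<and> K \<subseteq> slab"
  define S where "S = {i. i < feet * slopes \<and> member i \<subseteq> K}"
  define w where "w = vol K / vol slab"
  let ?A = "64 * L\<^sup>2 / (\<kappa> * h)" and ?E = "64 * L ^ 3 / (\<kappa> * h\<^sup>2)" and ?G = "16 * L ^ 3 / (\<kappa>\<^sup>2 * h)"
  have bK: "bounded K"
    using K bounded_subset[of slab K] by (auto simp: slab_def)
  have pos: "0 < \<kappa>" "0 < h" "0 < L" "0 < a" "0 < real slopes" "0 < real feet"
    using \<kappa> h L_pos a slopes_bounds feet_bounds by auto
  have volK: "vol K = w * (L ^ 3 * a)"
    using vol_slab pos by (simp add: w_def)
  have w0: "0 \<le> w"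
    by (simp add: w_def)
  have AEG: "0 < ?A" "0 < ?E" "0 < ?G"
    using pos by auto
  have "real (card S) \<le> concentration_bound \<sigma> L h \<kappa> * w powr (1 + \<sigma>) * (real feet * real slopes)"
  proof (cases "S = {}")
    case True
    then show ?thesis
      using AEG by (simp add: concentration_bound_def)
  next
    case False
    define J Q where "J = (\<lambda>i. i div slopes) ` S" and "Q = (\<lambda>i. i mod slopes) ` S"
    have finS: "finite S"
      by (simp add: S_def)
    note vols = members_in_convex_volume[OF conjunct1[OF K] bK]
    obtain i0 where i0: "i0 \<in> S" using False by blast
    have aw: "a \<le> ?G * w"
    proof -
      have "radius\<^sup>2 * h \<le> 16 * vol K"
        using vols(1)[of i0 i0] i0 by (simp add: S_def)
      then show ?thesis
        using pos unfolding radius_def volK by (simp add: field_simps power2_eq_square)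
    qed
    have J: "real (card J) \<le> feet * (?A * w) powr \<sigma> + 1"
    proof (rule card_feet_le)
      show "finite J" using finS by (simp add: J_def)
      show "0 \<le> ?A * w" by (intro mult_nonneg_nonneg less_imp_le AEG w0)
      fix i j assume "i \<in> J" "j \<in> J"
      then obtain m n where mn: "m \<in> S" "n \<in> S" "i = m div slopes" "j = n div slopes"
        by (auto simp: J_def)
      have "radius * h * (L / 8 * \<bar>offset j - offset i\<bar>) \<le> 8 * vol K"
        using vols(2)[of m n] mn by (simp add: S_def)
      then show "\<bar>offset j - offset i\<bar> \<le> ?A * w"
        using pos unfolding radius_def volK
        by (simp add: field_simps power2_eq_square power3_eq_cube)
    qed
    have Q: "real (card Q) \<le> slopes * (?E * w) + 1"
    proof (rule card_le_spread)
      show "finite Q" using finS by (simp add: Q_def)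
      show "0 \<le> slopes * (?E * w)" by (intro mult_nonneg_nonneg less_imp_le[OF AEG(2)] w0) simp
      fix i j assume "i \<in> Q" "j \<in> Q" "i \<le> j"
      then obtain m n where mn: "m \<in> S" "n \<in> S" "i = m mod slopes" "j = n mod slopes"
        by (auto simp: Q_def)
      have "radius * h\<^sup>2 * (\<bar>real j - real i\<bar> / (4 * slopes)) \<le> 16 * vol K"
        using vols(3)[of m n] mn by (simp add: S_def)
      then have "\<bar>real j - real i\<bar> \<le> slopes * (?E * w)"
        using pos unfolding radius_def volK by (simp add: field_simps power2_eq_square)
      then show "real j - real i \<le> slopes * (?E * w)"
        by simp
    qed
    have "inj_on (\<lambda>i. (i div slopes, i mod slopes)) S"
      by (rule inj_onI) (metis prod.inject div_mult_mod_eq)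
    moreover have "(\<lambda>i. (i div slopes, i mod slopes)) ` S \<subseteq> J \<times> Q"
      by (auto simp: J_def Q_def)
    ultimately have "card S \<le> card (J \<times> Q)"
      using finS by (intro card_inj_on_le) (auto simp: J_def Q_def)
    then have "card S \<le> card J * card Q"
      by (simp add: card_cartesian_product)
    then have "real (card S) \<le> real (card J) * real (card Q)"
      by (metis of_nat_le_iff of_nat_mult)
    also have "\<dots> \<le> (feet * ((?A powr \<sigma> + ?G powr \<sigma>) * w powr \<sigma>)) * (slopes * ((?E + ?G) * w))"
    \<comment> \<open>As \<open>a \<le> ?G * w\<close>, the rounding terms \<open>+ 1\<close> are at most \<open>feet * (?G * w) powr \<sigma>\<close> and \<open>slopes * (?G * w)\<close>.\<close>
    proof (rule mult_mono)
      have "1 = a powr - \<sigma> * a powr \<sigma>"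
        using pos by (simp flip: powr_add)
      also have "\<dots> \<le> feet * (?G * w) powr \<sigma>"
        using feet_bounds aw pos \<sigma> by (intro mult_mono powr_mono2) auto
      finally have "1 \<le> feet * (?G powr \<sigma> * w powr \<sigma>)"
        using AEG w0 by (simp only: powr_mult)
      moreover have "(?A * w) powr \<sigma> = ?A powr \<sigma> * w powr \<sigma>"
        by (rule powr_mult)
      ultimately show "real (card J) \<le> feet * ((?A powr \<sigma> + ?G powr \<sigma>) * w powr \<sigma>)"
        using J by (simp only: distrib_left distrib_right)
      have "1 = 1 / a * a"
        using pos by simp
      also have "\<dots> \<le> slopes * (?G * w)"
        using slopes_bounds aw pos by (intro mult_mono) auto
      finally show "real (card Q) \<le> slopes * ((?E + ?G) * w)"
        using Q by (simp only: distrib_left distrib_right)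
    qed auto
    also have "\<dots> = concentration_bound \<sigma> L h \<kappa> * (w powr \<sigma> * w) * (real feet * real slopes)"
      by (simp only: concentration_bound_def mult_ac)
    also have "w powr \<sigma> * w = w powr (1 + \<sigma>)"
      using w0 \<sigma> by (simp add: powr_add mult.commute powr_one_gt_zero_iff)
    finally show ?thesis .
  qed
  then show "real (card {i. i < feet * slopes \<and> member i \<subseteq> K}) / real (feet * slopes)
      \<le> concentration_bound \<sigma> L h \<kappa> * (vol K / vol slab) powr (1 + \<sigma>)"
    using pos by (simp add: S_def w_def field_simps)
qed

lemma member_volume_bounds:
  assumes "i < feet * slopes"
  shows "radius\<^sup>2 * h / 16 \<le> vol (member i)"
    and "vol (member i) \<le> 24 * unit_ball_vol 3 * h * radius\<^sup>2"
proof -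
  define p q where "p = foot (i div slopes)" and "q = p + h *\<^sub>R dir (slope (i mod slopes))"
  have T: "member i = tube radius p q"
    by (simp add: member_def Let_def p_def q_def)
  show "radius\<^sup>2 * h / 16 \<le> vol (member i)"
    using members_in_convex_volume(1)[of "member i" i i] assms convex_tube bounded_tube
    unfolding T by auto
  have "dist p q = h"
    using slope_range[of "i mod slopes"] div_mod_label[OF assms] h
    by (simp add: q_def dist_norm norm_dir)
  define n where "n = nat \<lceil>h / radius\<rceil>"
  have "1 \<le> h / radius"
    using a radius_pos by (simp add: radius_def)
  then have n: "h / radius \<le> n" "real (Suc n) \<le> 3 * (h / radius)" "0 < n"
    unfolding n_def by linarith+
  have "vol (member i) \<le> real (Suc n) * (8 * unit_ball_vol 3 * radius ^ 3)"
    unfolding T using n radius_pos \<open>dist p q = h\<close>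
    by (intro tube_volume_le) (auto simp: field_simps)
  also have "\<dots> \<le> 3 * (h / radius) * (8 * unit_ball_vol 3 * radius ^ 3)"
    using n radius_pos by (intro mult_right_mono) auto
  also have "\<dots> = 24 * unit_ball_vol 3 * h * radius\<^sup>2"
    using radius_pos by (simp add: power3_eq_cube power2_eq_square)
  finally show "vol (member i) \<le> 24 * unit_ball_vol 3 * h * radius\<^sup>2" .
qed

text \<open>
  Two-sided bounds are needed because \<open>q'\<close> may have either sign.
\<close>
lemma density_bounds:
  defines "dens \<equiv> shading_density (feet * slopes) member shading"
  shows "radius / (24 * h) \<le> dens" "dens \<le> 16 * unit_ball_vol 3 * radius / h"
proof -
  define N where "N = feet * slopes"
  define V :: real where "V = unit_ball_vol 3"
  have V: "0 < V" by (simp add: V_def)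
  have N: "0 < real N" using feet_bounds slopes_bounds by (simp add: N_def)
  have Y: "(\<Sum>i<N. vol (shading i)) = N * (V * radius ^ 3)"
    using radius_pos by (simp add: shading_def content_cball V_def)
  have lo: "N * (radius\<^sup>2 * h / 16) \<le> (\<Sum>i<N. vol (member i))"
    using sum_bounded_below[of "{..<N}" "radius\<^sup>2 * h / 16" "\<lambda>i. vol (member i)"]
      member_volume_bounds(1) by (simp add: N_def)
  have hi: "(\<Sum>i<N. vol (member i)) \<le> N * (24 * V * h * radius\<^sup>2)"
    using sum_bounded_above[of "{..<N}" "\<lambda>i. vol (member i)" "24 * V * h * radius\<^sup>2"]
      member_volume_bounds(2) by (simp add: N_def V_def)
  have lo_pos: "0 < N * (radius\<^sup>2 * h / 16)"
    using N radius_pos h by simp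
  then have T_pos: "0 < (\<Sum>i<N. vol (member i))"
    using lo by (rule less_le_trans)
  have dens: "dens = N * (V * radius ^ 3) / (\<Sum>i<N. vol (member i))"
    unfolding dens_def shading_density_def N_def[symmetric] Y ..
  have "radius / (24 * h) = N * (V * radius ^ 3) / (N * (24 * V * h * radius\<^sup>2))"
    using N V radius_pos h by (simp add: field_simps power3_eq_cube power2_eq_square)
  also have "\<dots> \<le> dens"
    unfolding dens using hi N V radius_pos
    by (intro divide_left_mono mult_pos_pos T_pos h) auto
  finally show "radius / (24 * h) \<le> dens" .
  have "dens \<le> N * (V * radius ^ 3) / (N * (radius\<^sup>2 * h / 16))"
    unfolding dens using lo lo_pos N V radius_pos by (intro divide_left_mono) auto
  also have "\<dots> = 16 * unit_ball_vol 3 * radius / h"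
    using N radius_pos h by (simp add: V_def field_simps power3_eq_cube power2_eq_square)
  finally show "dens \<le> 16 * unit_ball_vol 3 * radius / h" .
qed

text \<open>
  The shadings of all tubes with the same foot coincide, so only \<open>feet\<close>, at most
  \<open>2 * a powr - \<sigma>\<close>, balls have to be counted.
\<close>
lemma thickened_union_le:
  "vol (slab \<inter> nbhd a (shaded_union (feet * slopes) shading)) / vol slab
     \<le> 2 * unit_ball_vol 3 * (\<kappa> + 1) ^ 3 / L ^ 3 * a powr (2 - \<sigma>)"
proof -
  let ?U = "shaded_union (feet * slopes) shading"
  define V :: real where "V = unit_ball_vol 3"
  have V: "0 < V" by (simp add: V_def)
  have sub: "nbhd a ?U \<subseteq> (\<Union>j<feet. ball (foot j) (radius + a))"
  proof
    fix x assume "x \<in> nbhd a ?U"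
    then have "?U \<noteq> {}" "infdist x ?U < a" by (auto simp: nbhd_def)
    then obtain y where "y \<in> ?U" "dist x y < a"
      by (auto simp: infdist_notempty cINF_less_iff)
    then obtain i where i: "i < feet * slopes" "dist (foot (i div slopes)) y \<le> radius"
      by (auto simp: shaded_union_def shading_def)
    have "dist (foot (i div slopes)) x < radius + a"
      using i(2) \<open>dist x y < a\<close> dist_triangle2[of "foot (i div slopes)" x y] by linarith
    then show "x \<in> (\<Union>j<feet. ball (foot j) (radius + a))"
      using div_mod_label[OF i(1)] by auto
  qed
  have "open (nbhd a ?U)"
  proof -
    have "nbhd a ?U = (if ?U = {} then {} else {x. infdist x ?U < a})"
      by (auto simp: nbhd_def)
    then show ?thesis
      by (auto intro!: open_Collect_less continuous_intros)
  qed
  then have "slab \<inter> nbhd a ?U \<in> sets lebesgue"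
    by (intro sets.Int) (auto simp: slab_def)
  then have "vol (slab \<inter> nbhd a ?U) \<le> vol (\<Union>j<feet. ball (foot j) (radius + a))"
    using sub by (intro measure_mono_fmeasurable) (auto intro!: fmeasurable.finite_UN)
  also have "\<dots> \<le> (\<Sum>j<feet. vol (ball (foot j) (radius + a)))"
    by (intro measure_UNION_le) auto
  also have "\<dots> = feet * (V * (radius + a) ^ 3)"
    using radius_pos a by (simp add: content_ball V_def)
  also have "\<dots> \<le> (2 * a powr - \<sigma>) * (V * (radius + a) ^ 3)"
    using feet_bounds V radius_pos a by (intro mult_right_mono) auto
  also have "(radius + a) ^ 3 = (\<kappa> + 1) ^ 3 * a ^ 3"
    by (simp add: radius_def power_mult_distrib[symmetric] algebra_simps)
  finally have "vol (slab \<inter> nbhd a ?U) / vol slab \<le> (2 * a powr - \<sigma>) * (V * ((\<kappa> + 1) ^ 3 * a ^ 3)) / (L ^ 3 * a)"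
    unfolding vol_slab using L_pos a by (intro divide_right_mono) auto
  also have "\<dots> = 2 * V * (\<kappa> + 1) ^ 3 / L ^ 3 * (a powr - \<sigma> * a\<^sup>2)"
    using L_pos a by (simp add: field_simps power3_eq_cube power2_eq_square)
  also have "a powr - \<sigma> * a\<^sup>2 = a powr (2 - \<sigma>)"
    using a by (simp add: powr_diff powr_minus field_simps)
  finally show ?thesis
    by (simp add: V_def)
qed

end

section \<open>Sharpness of the exponent\<close>
lemma powr_ge_min_endpoints:
  fixes x y z q :: real
  assumes "0 < x" "x \<le> y" "y \<le> z"
  shows "min (x powr q) (z powr q) \<le> y powr q"
proof (cases "0 \<le> q")
  case True
  then show ?thesis using powr_mono2[of q x y] assms by (simp add: min.coboundedI1)
next
  case False
  then show ?thesis using powr_mono2'[of q y z] assms by (simp add: min.coboundedI2)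
qed

theorem proposition11p1:
  fixes \<sigma> q' \<epsilon> c_rad C_rad c_len C_len c_box C_box :: real
  assumes "0 < \<sigma>" and "\<sigma> \<le> 1"
    and "q' < 2 - \<sigma>"
    and "0 < \<epsilon>" and "\<epsilon> < 2 - \<sigma> - q'"
    and "0 < c_rad" and "c_rad \<le> C_rad"
    and "0 < c_len" and "c_len \<le> C_len"
    and "0 < c_box" and "c_box \<le> C_box"
    and "c_len \<le> C_box"
  shows "\<exists>C_star::real. \<not> (\<exists>c \<delta>0. 0 < c \<and> 0 < \<delta>0 \<and>
    (\<forall>\<delta> a b r. 0 < \<delta> \<and> \<delta> < \<delta>0 \<and> \<delta> \<le> a \<and> a \<le> b \<and> b \<le> r \<longrightarrow>
      (\<forall>B N T Y C0.
         is_box c_box C_box a b r B \<and> 1 \<le> N \<and>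
         shaded_family (is_tube c_rad C_rad c_len C_len \<delta> r) B N T Y \<and>
         C0 \<le> C_star \<and> convex_concentration_le C0 (1 + \<sigma>) B N T
         \<longrightarrow> vol (B \<inter> nbhd a (shaded_union N Y)) / vol B
               \<ge> c * (a / b) powr \<epsilon> * shading_density N T Y powr q')))"
proof -
  define L h where "L = C_box" and "h = c_len"
  \<comment> \<open>With \<open>\<delta> = a / m\<close> the slab is thick enough for tubes of radius \<open>c_rad * \<delta> = \<kappa> * a\<close>, and \<open>\<delta> \<le> a\<close>.\<close>
  define m where "m = max 1 (2 * c_rad / L)"
  define \<kappa> where "\<kappa> = c_rad / m"
  define V :: real where "V = unit_ball_vol 3"
  have L: "0 < L" and h: "0 < h" "h \<le> L"
    using assms by (simp_all add: L_def h_def)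
  have m: "1 \<le> m" "2 * c_rad \<le> m * L"
    using L by (simp_all add: m_def max_def field_simps)
  have \<kappa>: "0 < \<kappa>" "2 * \<kappa> \<le> L"
    using assms m by (simp_all add: \<kappa>_def field_simps)
  have V: "0 < V" by (simp add: V_def)
  show ?thesis
  proof (intro exI[of _ "concentration_bound \<sigma> L h \<kappa>"] notI, elim exE conjE)
    fix c \<delta>0 :: real
    assume c: "0 < c" and \<delta>0: "0 < \<delta>0"
    assume bound: "\<forall>\<delta> a b r. 0 < \<delta> \<and> \<delta> < \<delta>0 \<and> \<delta> \<le> a \<and> a \<le> b \<and> b \<le> r \<longrightarrow>
      (\<forall>B N T Y C0.
         is_box c_box C_box a b r B \<and> 1 \<le> N \<and>
         shaded_family (is_tube c_rad C_rad c_len C_len \<delta> r) B N T Y \<and>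
         C0 \<le> concentration_bound \<sigma> L h \<kappa> \<and> convex_concentration_le C0 (1 + \<sigma>) B N T
         \<longrightarrow> vol (B \<inter> nbhd a (shaded_union N Y)) / vol B
               \<ge> c * (a / b) powr \<epsilon> * shading_density N T Y powr q')"
    define P where "P = 2 * V * (\<kappa> + 1) ^ 3 / L ^ 3"
    define R where "R = min ((\<kappa> / (24 * h)) powr q') ((16 * V * \<kappa> / h) powr q')"
    define \<tau> where "\<tau> = 2 - \<sigma> - q' - \<epsilon>"
    have P: "0 < P" and R: "0 < R" and \<tau>: "0 < \<tau>"
      using V \<kappa> L h assms by (simp_all add: P_def R_def \<tau>_def)
    \<comment> \<open>The last entry makes \<open>a powr \<tau> < c * R / P\<close>; \<open>\<delta>0 / 2\<close> makes \<open>\<delta> \<le> a < \<delta>0\<close>; the others are the size conditions of the construction.\<close>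
    define a where "a = Min {1, L / (64 * \<kappa>), h / \<kappa>, \<delta>0 / 2, (c * R / P) powr (1 / \<tau>) / 2}"
    have a: "0 < a"
      using L \<kappa> h \<delta>0 c P R by (simp add: a_def)
    have "a \<le> 1" "a \<le> L / (64 * \<kappa>)" "a \<le> h / \<kappa>" "a \<le> \<delta>0 / 2"
      "a \<le> (c * R / P) powr (1 / \<tau>) / 2"
      unfolding a_def by (rule Min_le; simp)+
    then have a_le: "a \<le> 1" "\<kappa> * a \<le> L / 64" "\<kappa> * a \<le> h" "a < \<delta>0"
      and a_small: "a < (c * R / P) powr (1 / \<tau>)"
      using \<kappa> \<delta>0 a by (auto simp: field_simps)
    interpret transversal_tubes \<sigma> L h \<kappa> a
      by unfold_locales (use assms h \<kappa> a a_le in auto)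
    define \<delta> where "\<delta> = a / m"
    have \<delta>: "0 < \<delta>" "\<delta> \<le> a" "c_rad * \<delta> = radius"
      using a m by (auto simp: \<delta>_def radius_def field_simps) (simp add: \<kappa>_def)
    define dens where "dens = shading_density (feet * slopes) member shading"
    have "is_box c_box C_box a 1 1 slab"
      unfolding is_box_def
    proof (intro exI conjI)
      show "orthogonal_transformation (id :: real^3 \<Rightarrow> real^3)"
        by (simp add: orthogonal_transformation linear_id)
      show "slab = (\<lambda>x. 0 + id x) ` cbox 0 (vector [L * a, L, L])"
        by (simp add: slab_def)
    qed (use assms a in \<open>auto simp: L_def\<close>)
    moreover have "1 \<le> feet * slopes"
      using feet_bounds slopes_bounds by (simp add: Suc_le_eq)
    moreover have "shaded_family (is_tube c_rad C_rad c_len C_len \<delta> 1) slab (feet * slopes) member shading"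
      unfolding shaded_family_def
    proof (intro allI impI conjI)
      fix i assume i: "i < feet * slopes"
      define p q where "p = foot (i div slopes)" and "q = p + h *\<^sub>R dir (slope (i mod slopes))"
      have T: "member i = tube radius p q"
        by (simp add: member_def Let_def p_def q_def)
      have "dist p q = h"
        using slope_range[of "i mod slopes"] div_mod_label[OF i] h
        by (simp add: q_def dist_norm norm_dir)
      moreover have "radius \<le> C_rad * \<delta>"
        using \<delta> assms by (metis mult_right_mono less_imp_le)
      ultimately show "is_tube c_rad C_rad c_len C_len \<delta> 1 (member i)"
        unfolding is_tube_def T using assms \<delta> by (intro exI[of _ p] exI[of _ q] exI[of _ radius]) (simp add: h_def)
      show "member i \<subseteq> slab"
        by (rule member_subset_slab[OF i])
      show "shading i \<in> sets lebesgue"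
        by (simp add: shading_def)
      show "shading i \<subseteq> member i"
        unfolding T shading_def p_def[symmetric] by (rule cball_subset_tube[of p]) auto
    qed
    ultimately have "c * (a / 1) powr \<epsilon> * dens powr q'
        \<le> vol (slab \<inter> nbhd a (shaded_union (feet * slopes) shading)) / vol slab"
      unfolding dens_def using \<delta> a_le concentration
      by (intro bound[rule_format, where \<delta> = \<delta> and r = 1 and ?C0.0 = "concentration_bound \<sigma> L h \<kappa>"])
        (assumption | intro conjI | linarith)+
    also have "\<dots> \<le> P * a powr (2 - \<sigma>)"
      using thickened_union_le by (simp add: P_def V_def)
    finally have upper: "c * a powr \<epsilon> * dens powr q' \<le> P * a powr (2 - \<sigma>)"
      by simp
    have "R * a powr q' = min ((\<kappa> / (24 * h) * a) powr q') ((16 * V * \<kappa> / h * a) powr q')"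
      unfolding R_def powr_mult by (simp add: min_mult_distrib_right)
    also have "\<dots> \<le> dens powr q'"
      using density_bounds \<kappa> h a
      by (intro powr_ge_min_endpoints) (auto simp: dens_def radius_def V_def mult_ac)
    finally have "c * a powr \<epsilon> * (R * a powr q') \<le> P * a powr (2 - \<sigma>)"
      using upper c by (smt (verit) mult_left_mono powr_ge_zero mult_nonneg_nonneg)
    also have "a powr (2 - \<sigma>) = a powr \<epsilon> * a powr q' * a powr \<tau>"
      by (simp add: \<tau>_def flip: powr_add)
    finally have "c * R \<le> P * a powr \<tau>"
      using a by (simp add: mult_ac)
    then have "c * R / P \<le> a powr \<tau>"
      using P by (simp add: field_simps)
    moreover have "a powr \<tau> < ((c * R / P) powr (1 / \<tau>)) powr \<tau>"
      using a a_small \<tau> by (intro powr_less_mono2) auto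
    then have "a powr \<tau> < c * R / P"
      using \<tau> c P R by (simp add: powr_powr)
    ultimately show False by simp
  qed
qed

end
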